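(* Let $\delta>0$ be a real constant, and let $\boldsymbol z_l=(z_{1,l},\dots,z_{5,l})$ and $\boldsymbol z_r=(z_{1,r},\dots,z_{5,r})$ be two vectors in $\mathbb R^5$, where $\boldsymbol z=(z_1,z_2,z_3,z_4,z_5)=(\rho,v_1,v_2,v_3,T)$. Assume that each of the two states is admissible, i.e. for both $s=l$ and $s=r$, $$0<z_{1,s}<3,\qquad z_{5,s}>\tfrac{27}{32},\qquad 4z_{5,s}-z_{1,s}(3-z_{1,s})^2>0,$$ and assume that the arithmetic means satisfy $$4\langle z_5\rangle-\langle z_1\rangle\,(3-\langle z_1\rangle)^2>0 .$$ Then the following system of linear equations in the ten real unknowns $\widetilde U_1,\dots,\widetilde U_5$ and $\widetilde F_{1},\dots,\widetilde F_{5}$ has a unique solution. Equations for $\widetilde U=(\widetilde U_1,\dots,\widetilde U_5)$: $$\left(\frac{1}{\langle z_1\rangle^{\ln}}+\frac{1}{\langle 3-z_1\rangle^{\ln}}+\frac{3}{(3-z_{1,l})(3-z_{1,r})}-\frac{9}{4\langle z_5\rangle}\right)\widetilde U_1=\langle z_1\rangle\left(-\frac{9}{8}\frac{1}{\langle z_5\rangle}+\frac{3}{(3-z_{1,l})(3-z_{1,r})}\right)+\left\langle-\frac98\frac{z_1}{z_5}+\frac{3}{3-z_1}\right\rangle,$$ $$-\frac{1}{\langle z_5\rangle}\langle z_m\rangle\,\widetilde U_1+\frac{1}{\langle z_5\rangle}\widetilde U_m=0,\qquad m=2,3,4,$$ $$\left(\frac12\sum_{m=2}^4\frac{1}{\langle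 z_5\rangle}\left\langle\frac{z_m^2}{z_5}\right\rangle-\frac{1}{\delta\langle z_5\rangle^{\ln}}+\frac94\frac{1}{\langle z_5\rangle}\left\langle\frac{z_1}{z_5}\right\rangle\right)\widetilde U_1-\sum_{m=2}^4\frac{1}{\langle z_5\rangle}\left\langle\frac{z_m}{z_5}\right\rangle\widetilde U_m+\frac{1}{\langle z_5\rangle}\left\langle\frac{1}{z_5}\right\rangle\widetilde U_5=\frac98\frac{\langle z_1\rangle}{\langle z_5\rangle}\left\langle\frac{z_1}{z_5}\right\rangle.$$ Equations for $\widetilde F=(\widetilde F_{1},\dots,\widetilde F_{5})$: $$\left(\frac{1}{\langle z_1\rangle^{\ln}}+\frac{1}{\langle 3-z_1\rangle^{\ln}}+\frac{3}{(3-z_{1,l})(3-z_{1,r})}-\frac{9}{4\langle z_5\rangle}\right)\widetilde F_{1}=\langle z_1z_2\rangle\left(-\frac{9}{8}\frac{1}{\langle z_5\rangle}+\frac{3}{(3-z_{1,l})(3-z_{1,r})}\right)+\left\langle-\frac98\frac{z_1}{z_5}+\frac{3}{3-z_1}\right\rangle\langle z_2\rangle,$$ $$-\frac{1}{\langle z_5\rangle}\langle z_2\rangle\,\widetilde F_{1}+\frac{1}{\langle z_5\rangle}\widetilde F_{2}=\langle z_1\rangle\left\langle-\frac98\frac{z_1}{z_5}+\frac{3}{3-z_1}\right\rangle,$$ $$-\frac{1}{\langle z_5\rangle}\langle z_m\rangle\,\widetilde F_{1}+\frac{1}{\langle z_5\rangle}\widetilde F_{m}=0,\qquad m=3,4,$$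 $$\left(\frac12\sum_{m=2}^4\frac{1}{\langle z_5\rangle}\left\langle\frac{z_m^2}{z_5}\right\rangle-\frac{1}{\delta\langle z_5\rangle^{\ln}}+\frac94\frac{1}{\langle z_5\rangle}\left\langle\frac{z_1}{z_5}\right\rangle\right)\widetilde F_{1}-\sum_{m=2}^4\frac{1}{\langle z_5\rangle}\left\langle\frac{z_m}{z_5}\right\rangle\widetilde F_{m}+\frac{1}{\langle z_5\rangle}\left\langle\frac{1}{z_5}\right\rangle\widetilde F_{5}=\frac{9\langle z_1z_2\rangle}{8\langle z_5\rangle}\left\langle\frac{z_1}{z_5}\right\rangle.$$
   Context: Notation. For a quantity $a$ computed from a state $\boldsymbol z$ (for instance $a=z_1$, $a=z_1/z_5$, $a=z_m^2/z_5$, $a=z_1z_2$, $a=3-z_1$), $a_l$ and $a_r$ denote its values at $\boldsymbol z_l$ and $\boldsymbol z_r$; $\langle a\rangle=(a_l+a_r)/2$ is the arithmetic mean; and, for $a_l,a_r>0$, $\langle a\rangle^{\ln}=\dfrac{a_r-a_l}{\ln a_r-\ln a_l}$ is the logarithmic mean, with $\langle a\rangle^{\ln}=a_l$ when $a_l=a_r$. Background. The states are dimensionless states of the three-dimensional compressible Euler equations with the van der Waals equation of state $p=\frac{8\rho T}{3-\rho}-3\rho^2$, $e=\frac{T}{\delta}-\frac98\rho$, where $\rho$ is the density, $(v_1,v_2,v_3)\in\mathbb R^3$ the velocity, $T$ the temperature, $p$ the pressure, $e$ the specific internal energy and $\delta=\gamma-1=R/c_v>0$ a constant ($R$ the gas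 constant, $c_v$ the specific heat at constant volume). The system in the claim determines the components of a two-point symmetric entropy conservative flux: $\widetilde U=\widetilde{\boldsymbol U}$ and $\widetilde F=\widetilde{\boldsymbol F}_1$ (the flux in the first coordinate direction). *)

theory Defs
  imports "HOL-Analysis.Analysis"
begin

text \<open>
  A state is \<open>z = (z\<^sub>1, \<dots>, z\<^sub>5) = (\<rho>, v\<^sub>1, v\<^sub>2, v\<^sub>3, T)\<close>. The components are indexed by the
  type \<open>5\<close>, i.e. by the integers modulo 5: the index \<open>5\<close> is the element \<open>0\<close> of that type, and
  \<open>1, 2, 3, 4, 5\<close> are its five distinct elements.
\<close>

type_synonym state = "real^5"

definition arith_mean :: "state \<Rightarrow> state \<Rightarrow> (state \<Rightarrow> real) \<Rightarrow> real" where
  "arith_mean zl zr a = (a zl + a zr) / 2"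

definition log_mean :: "state \<Rightarrow> state \<Rightarrow> (state \<Rightarrow> real) \<Rightarrow> real" where
  "log_mean zl zr a =
     (if a zl = a zr then a zl else (a zr - a zl) / (ln (a zr) - ln (a zl)))"

definition admissible :: "state \<Rightarrow> bool" where
  "admissible z \<longleftrightarrow>
     0 < z $ 1 \<and> z $ 1 < 3 \<and> z $ 5 > 27 / 32 \<and> 4 * z $ 5 - z $ 1 * (3 - z $ 1)^2 > 0"

text \<open>
  The systems are posed for the van der Waals equation of state
  \<open>p = 8 \<rho> T / (3 - \<rho>) - 3 \<rho>\<^sup>2\<close>, \<open>e = T / \<delta> - 9/8 \<rho>\<close>. \<open>U\<close> is the two-point state, \<open>F\<close> the
  two-point entropy conservative flux in the first coordinate direction.
\<close>

definition U_system :: "real \<Rightarrow> state \<Rightarrow> state \<Rightarrow> real^5 \<Rightarrow> bool" where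
  "U_system \<delta> zl zr U \<longleftrightarrow>
    (let A = arith_mean zl zr; L = log_mean zl zr in
      (1 / L (\<lambda>z. z $ 1) + 1 / L (\<lambda>z. 3 - z $ 1) + 3 / ((3 - zl $ 1) * (3 - zr $ 1))
          - 9 / (4 * A (\<lambda>z. z $ 5))) * U $ 1
        = A (\<lambda>z. z $ 1) * (- (9 / 8) * (1 / A (\<lambda>z. z $ 5)) + 3 / ((3 - zl $ 1) * (3 - zr $ 1)))
          + A (\<lambda>z. - (9 / 8) * (z $ 1 / z $ 5) + 3 / (3 - z $ 1)) \<and>
      (\<forall>m\<in>{2, 3, 4}.
        - (1 / A (\<lambda>z. z $ 5)) * A (\<lambda>z. z $ m) * U $ 1 + 1 / A (\<lambda>z. z $ 5) * U $ m = 0) \<and>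
      (1 / 2 * (\<Sum>m\<in>{2, 3, 4}. 1 / A (\<lambda>z. z $ 5) * A (\<lambda>z. (z $ m)^2 / z $ 5))
          - 1 / (\<delta> * L (\<lambda>z. z $ 5))
          + 9 / 4 * (1 / A (\<lambda>z. z $ 5)) * A (\<lambda>z. z $ 1 / z $ 5)) * U $ 1
        - (\<Sum>m\<in>{2, 3, 4}. 1 / A (\<lambda>z. z $ 5) * A (\<lambda>z. z $ m / z $ 5) * U $ m)
        + 1 / A (\<lambda>z. z $ 5) * A (\<lambda>z. 1 / z $ 5) * U $ 5
        = 9 / 8 * (A (\<lambda>z. z $ 1) / A (\<lambda>z. z $ 5)) * A (\<lambda>z. z $ 1 / z $ 5))"

definition F_system :: "real \<Rightarrow> state \<Rightarrow> state \<Rightarrow> real^5 \<Rightarrow> bool" where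
  "F_system \<delta> zl zr F \<longleftrightarrow>
    (let A = arith_mean zl zr; L = log_mean zl zr in
      (1 / L (\<lambda>z. z $ 1) + 1 / L (\<lambda>z. 3 - z $ 1) + 3 / ((3 - zl $ 1) * (3 - zr $ 1))
          - 9 / (4 * A (\<lambda>z. z $ 5))) * F $ 1
        = A (\<lambda>z. z $ 1 * z $ 2)
            * (- (9 / 8) * (1 / A (\<lambda>z. z $ 5)) + 3 / ((3 - zl $ 1) * (3 - zr $ 1)))
          + A (\<lambda>z. - (9 / 8) * (z $ 1 / z $ 5) + 3 / (3 - z $ 1)) * A (\<lambda>z. z $ 2) \<and>
      - (1 / A (\<lambda>z. z $ 5)) * A (\<lambda>z. z $ 2) * F $ 1 + 1 / A (\<lambda>z. z $ 5) * F $ 2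
        = A (\<lambda>z. z $ 1) * A (\<lambda>z. - (9 / 8) * (z $ 1 / z $ 5) + 3 / (3 - z $ 1)) \<and>
      (\<forall>m\<in>{3, 4}.
        - (1 / A (\<lambda>z. z $ 5)) * A (\<lambda>z. z $ m) * F $ 1 + 1 / A (\<lambda>z. z $ 5) * F $ m = 0) \<and>
      (1 / 2 * (\<Sum>m\<in>{2, 3, 4}. 1 / A (\<lambda>z. z $ 5) * A (\<lambda>z. (z $ m)^2 / z $ 5))
          - 1 / (\<delta> * L (\<lambda>z. z $ 5))
          + 9 / 4 * (1 / A (\<lambda>z. z $ 5)) * A (\<lambda>z. z $ 1 / z $ 5)) * F $ 1
        - (\<Sum>m\<in>{2, 3, 4}. 1 / A (\<lambda>z. z $ 5) * A (\<lambda>z. z $ m / z $ 5) * F $ m)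
        + 1 / A (\<lambda>z. z $ 5) * A (\<lambda>z. 1 / z $ 5) * F $ 5
        = 9 * A (\<lambda>z. z $ 1 * z $ 2) / (8 * A (\<lambda>z. z $ 5)) * A (\<lambda>z. z $ 1 / z $ 5))"

end

theory Submission
  imports Defs
begin

text \<open>
  Each of the two systems is triangular: the first equation involves only the mass component,
  each momentum equation then determines one momentum component, and the last equation determines
  the energy component. The momentum and energy pivots are positive because temperatures are.
  Everything therefore rests on the first pivot
  \<open>1/\<langle>\<rho>\<rangle>\<^sup>l\<^sup>n + 1/\<langle>3 - \<rho>\<rangle>\<^sup>l\<^sup>n + 3/((3 - \<rho>\<^sub>l)(3 - \<rho>\<^sub>r)) - 9/(4\<langle>T\<rangle>)\<close>,
  shown to be positive in \<open>density_coefficient_pos\<close>.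

  With \<open>r = \<langle>\<rho>\<rangle>\<close>, the logarithmic mean is at most the arithmetic mean, and so is the geometric
  mean. Hence the first three terms are at least
  \<open>1/r + 1/(3 - r) + 3/(3 - r)\<^sup>2 = 9/(r (3 - r)\<^sup>2)\<close>,
  and this exceeds \<open>9/(4\<langle>T\<rangle>)\<close> exactly when \<open>4\<langle>T\<rangle> > r (3 - r)\<^sup>2\<close>, which is the
  admissibility condition imposed on the averaged state. The bound is attained at
  \<open>z\<^sub>l = z\<^sub>r\<close>, where the positivity of the pivot is the thermodynamic stability
  \<open>\<partial>p/\<partial>\<rho> > 0\<close> at constant temperature.
\<close>

lemma two_div_sum_le_ln_slope:
  fixes a b :: real
  assumes "0 < a" "0 < b" "a \<noteq> b"
  shows "2 / (a + b) \<le> (ln b - ln a) / (b - a)"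
proof -
  have ordered: "2 / (u + v) \<le> (ln v - ln u) / (v - u)" if "0 < u" "u < v" for u v :: real
    using ln_inverse_approx_ge[OF that] that by (simp add: pos_le_divide_eq)
  have "(ln a - ln b) / (a - b) = (ln b - ln a) / (b - a)"
    by (metis minus_diff_eq minus_divide_divide)
  then show ?thesis
    using ordered[of a b] ordered[of b a] assms
    by (cases "a < b") (simp_all add: add.commute)
qed

text \<open>
  The inequality between the logarithmic and the arithmetic mean, in the reciprocal form in which
  the means enter the pivot.
\<close>

lemma inverse_arith_mean_le_inverse_log_mean:
  assumes "0 < a zl" "0 < a zr"
  shows "1 / arith_mean zl zr a \<le> 1 / log_mean zl zr a"
  using two_div_sum_le_ln_slope[of "a zl" "a zr"] assms
  by (simp add: arith_mean_def log_mean_def)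

text \<open>
  Comparing each mean with the arithmetic one replaces the three density terms by their values at
  the averaged density, where they sum to a single fraction that the condition on the averaged
  state compares with \<open>9/(4\<langle>T\<rangle>)\<close>.
\<close>

lemma density_coefficient_pos:
  assumes "admissible zl" "admissible zr"
    and mean: "4 * arith_mean zl zr (\<lambda>z. z $ 5)
          - arith_mean zl zr (\<lambda>z. z $ 1) * (3 - arith_mean zl zr (\<lambda>z. z $ 1))^2 > 0"
  shows "0 < 1 / log_mean zl zr (\<lambda>z. z $ 1) + 1 / log_mean zl zr (\<lambda>z. 3 - z $ 1)
             + 3 / ((3 - zl $ 1) * (3 - zr $ 1)) - 9 / (4 * arith_mean zl zr (\<lambda>z. z $ 5))"
proof -
  define r T where "r = arith_mean zl zr (\<lambda>z. z $ 1)" and "T = arith_mean zl zr (\<lambda>z. z $ 5)"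
  have bounds: "0 < zl $ 1" "zl $ 1 < 3" "0 < zr $ 1" "zr $ 1 < 3"
    using assms by (auto simp: admissible_def)
  then have r: "0 < r" "r < 3" by (auto simp: r_def arith_mean_def)
  have T: "0 < T" using assms by (simp add: T_def arith_mean_def admissible_def)
  have "1 / r \<le> 1 / log_mean zl zr (\<lambda>z. z $ 1)"
    unfolding r_def by (rule inverse_arith_mean_le_inverse_log_mean) (use bounds in auto)
  moreover have "1 / (3 - r) \<le> 1 / log_mean zl zr (\<lambda>z. 3 - z $ 1)"
  proof -
    have "3 - r = arith_mean zl zr (\<lambda>z. 3 - z $ 1)"
      by (simp add: r_def arith_mean_def field_simps)
    then show ?thesis
      using inverse_arith_mean_le_inverse_log_mean[of "\<lambda>z. 3 - z $ 1"] bounds by simp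
  qed
  moreover have "3 / (3 - r)\<^sup>2 \<le> 3 / ((3 - zl $ 1) * (3 - zr $ 1))"
  proof (rule divide_left_mono)
    (* the gap between the squared arithmetic and the squared geometric mean *)
    have "(3 - r)\<^sup>2 - (3 - zl $ 1) * (3 - zr $ 1) = ((zl $ 1 - zr $ 1) / 2)\<^sup>2"
      by (simp add: r_def arith_mean_def power2_eq_square field_simps)
    then show "(3 - zl $ 1) * (3 - zr $ 1) \<le> (3 - r)\<^sup>2"
      by (smt (verit) zero_le_power2)
  qed (use bounds r in auto)
  moreover have "9 / (4 * T) < 9 / (r * (3 - r)\<^sup>2)"
    by (rule divide_strict_left_mono) (use mean r T in \<open>auto simp: r_def T_def\<close>)
  moreover have "1 / r + 1 / (3 - r) + 3 / (3 - r)\<^sup>2 = 9 / (r * (3 - r)\<^sup>2)"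
  proof -
    have "1 / r + 1 / s + 3 / s\<^sup>2 = 9 / (r * s\<^sup>2)" if "0 < s" "r = 3 - s" for s
      using r that by (simp add: divide_simps) (simp add: power2_eq_square algebra_simps)
    from this[of "3 - r"] show ?thesis using r by simp
  qed
  ultimately show ?thesis unfolding T_def by linarith
qed

lemma exhaust_5: "x = 1 \<or> x = 2 \<or> x = 3 \<or> x = 4 \<or> x = 5" for x :: 5
proof (induct x)
  case (of_int z)
  then have "0 \<le> z" "z < 5" by simp_all
  then have "z = 0 \<or> z = 1 \<or> z = 2 \<or> z = 3 \<or> z = 4" by arith
  then show ?case by auto
qed

text \<open>
  The common shape of both systems, solved by forward substitution. The momentum right-hand sides
  \<open>r\<close> are left arbitrary because the flux has a pressure term in the momentum equation of its
  own direction, while those of \<open>U\<close> all vanish.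
\<close>

lemma ex1_triangular_system:
  fixes c d e p s t :: real and a q r :: "5 \<Rightarrow> real"
  assumes "c \<noteq> 0" "d \<noteq> 0" "e \<noteq> 0"
  shows "\<exists>!x :: real^5. c * x $ 1 = s \<and>
           (\<forall>m\<in>{2, 3, 4}. - d * a m * x $ 1 + d * x $ m = r m) \<and>
           p * x $ 1 - (\<Sum>m\<in>{2, 3, 4}. q m * x $ m) + e * x $ 5 = t"
proof -
  define x1 where "x1 = s / c"
  define xm where "xm m = (r m + d * a m * x1) / d" for m
  define x5 where "x5 = (t - p * x1 + (\<Sum>m\<in>{2, 3, 4}. q m * xm m)) / e"
  define sol :: "real^5" where
    "sol = (\<chi> i. if i = 1 then x1 else if i = 5 then x5 else xm i)"
  have solved: "c * x $ 1 = s \<and>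
        (\<forall>m\<in>{2, 3, 4}. - d * a m * x $ 1 + d * x $ m = r m) \<and>
        p * x $ 1 - (\<Sum>m\<in>{2, 3, 4}. q m * x $ m) + e * x $ 5 = t
      \<longleftrightarrow> x $ 1 = x1 \<and> (\<forall>m\<in>{2, 3, 4}. x $ m = xm m) \<and> x $ 5 = x5" for x :: "real^5"
  proof -
    have "c * x $ 1 = s \<longleftrightarrow> x $ 1 = x1"
      using assms by (auto simp: x1_def field_simps)
    moreover have "- d * a m * x1 + d * x $ m = r m \<longleftrightarrow> x $ m = xm m" for m
      using assms by (auto simp: xm_def field_simps)
    moreover have "p * x1 - (\<Sum>m\<in>{2, 3, 4}. q m * xm m) + e * x $ 5 = t \<longleftrightarrow> x $ 5 = x5"
      using assms by (auto simp: x5_def field_simps)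
    ultimately show ?thesis by (auto cong: sum.cong)
  qed
  also have "\<dots> x \<longleftrightarrow> x = sol" for x
    using exhaust_5 by (auto simp: sol_def vec_eq_iff)
  finally show ?thesis by simp
qed

theorem theorem3p1:
  fixes \<delta> :: real and zl zr :: "real^5"
  assumes "\<delta> > 0"
    and "admissible zl" and "admissible zr"
    and "4 * arith_mean zl zr (\<lambda>z. z $ 5)
          - arith_mean zl zr (\<lambda>z. z $ 1) * (3 - arith_mean zl zr (\<lambda>z. z $ 1))^2 > 0"
  shows "\<exists>!(U, F). U_system \<delta> zl zr U \<and> F_system \<delta> zl zr F"
proof -
  let ?A = "arith_mean zl zr"
  have density: "1 / log_mean zl zr (\<lambda>z. z $ 1) + 1 / log_mean zl zr (\<lambda>z. 3 - z $ 1)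
      + 3 / ((3 - zl $ 1) * (3 - zr $ 1)) - 9 / (4 * ?A (\<lambda>z. z $ 5)) \<noteq> 0"
    using density_coefficient_pos assms by (metis less_irrefl)
  have "0 < zl $ 5" "0 < zr $ 5" using assms by (auto simp: admissible_def)
  then have temperature: "0 < ?A (\<lambda>z. z $ 5)" "0 < ?A (\<lambda>z. 1 / z $ 5)"
    by (auto simp: arith_mean_def intro!: add_pos_pos)
  have momentum: "1 / ?A (\<lambda>z. z $ 5) \<noteq> 0" and
    energy: "1 / ?A (\<lambda>z. z $ 5) * ?A (\<lambda>z. 1 / z $ 5) \<noteq> 0"
    using temperature by auto
  note solvable = ex1_triangular_system[OF density momentum energy]
  have "\<exists>!U. U_system \<delta> zl zr U"
    unfolding U_system_def Let_def by (rule solvable)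
  moreover have "\<exists>!F. F_system \<delta> zl zr F"
  proof -
    let ?k = "?A (\<lambda>z. z $ 1) * ?A (\<lambda>z. - (9 / 8) * (z $ 1 / z $ 5) + 3 / (3 - z $ 1))"
    (* the flux system states its first momentum equation, which carries the pressure term ?k,
       apart from the other two *)
    have split: "(\<forall>m\<in>{2, 3, 4 :: 5}. f m = (if m = 2 then ?k else 0)) \<longleftrightarrow>
        f 2 = ?k \<and> (\<forall>m\<in>{3, 4}. f m = 0)" for f :: "5 \<Rightarrow> real"
      by auto
    show ?thesis
      unfolding F_system_def Let_def
      by (rule solvable[where a = "\<lambda>m. ?A (\<lambda>z. z $ m)" and r = "\<lambda>m. if m = 2 then ?k else 0",
            unfolded split conj_assoc])
  qed
  ultimately show ?thesis by auto
qed

end
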